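(* Let $m,n$ be positive integers. If $n\ge 2$, then $$f_m(n,2)=mn+m.$$ If $k\in\{3,4\}$ and $n\ge k-1$, then $$mn+(m+1)(k-1)-1\le f_m(n,k)\le mn+m\binom{k}{2}.$$
   Context: For positive integers $m,n$ let $mB^n=\{0,1,\ldots,m\}^n\subseteq\mathbb{R}^n$. A family of affine hyperplanes in $\mathbb{R}^n$ is a finite multiset, so repetitions are allowed and counted. A point is covered $j$ times by the family if exactly $j$ members of the multiset contain it. For a positive integer $k$, $f_m(n,k)$ denotes the minimum size of a family of affine hyperplanes in $\mathbb{R}^n$ such that every point of $mB^n\setminus\{\mathbf 0\}$ is covered at least $k$ times and the origin $\mathbf 0$ is covered by no member of the family. *)

theory Defs
  imports Complex_Main "HOL-Library.Multiset"
begin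

text \<open>Points of R^n are functions nat => real, only coordinates i < n matter.
An affine hyperplane in R^n is given by a pair (a, b) with a restricted to
{0..<n} nonzero; it is the set of x with sum_{i<n} a i * x i = b.\<close>

type_synonym hplane = "(nat \<Rightarrow> real) \<times> real"

definition is_hyperplane :: "nat \<Rightarrow> hplane \<Rightarrow> bool" where
  "is_hyperplane n h \<longleftrightarrow> (\<exists>i<n. fst h i \<noteq> 0)"

definition on_hp :: "nat \<Rightarrow> hplane \<Rightarrow> (nat \<Rightarrow> real) \<Rightarrow> bool" where
  "on_hp n h x \<longleftrightarrow> (\<Sum>i<n. fst h i * x i) = snd h"

definition grid :: "nat \<Rightarrow> nat \<Rightarrow> (nat \<Rightarrow> real) set" where
  "grid m n = {x. (\<forall>i<n. x i \<in> real ` {0..m}) \<and> (\<forall>i\<ge>n. x i = 0)}"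

definition cov :: "nat \<Rightarrow> hplane multiset \<Rightarrow> (nat \<Rightarrow> real) \<Rightarrow> nat" where
  "cov n H x = size (filter_mset (\<lambda>h. on_hp n h x) H)"

definition admissible :: "nat \<Rightarrow> nat \<Rightarrow> nat \<Rightarrow> hplane multiset \<Rightarrow> bool" where
  "admissible m n k H \<longleftrightarrow>
     (\<forall>h\<in>#H. is_hyperplane n h) \<and>
     (\<forall>x\<in>grid m n - {(\<lambda>_. 0)}. cov n H x \<ge> k) \<and>
     cov n H (\<lambda>_. 0) = 0"

definition f :: "nat \<Rightarrow> nat \<Rightarrow> nat \<Rightarrow> nat" where
  "f m n k = (LEAST s. \<exists>H. admissible m n k H \<and> size H = s)"

end

theory Submission
  imports Defs "HOL-Library.FuncSet" "HOL-Computational_Algebra.Polynomial_FPS"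
begin

text \<open>
  Let P be the product of the affine forms of an admissible family: it vanishes to order k at every
  nonzero grid point and not at the origin. Let G(x) be the product of the series \<open>1 / (1 - x / w)\<close>
  over the set W of nonzero coordinates of grid points. If the Taylor coefficients of order less
  than e of a polynomial p in one variable vanish at all w in W and \<open>deg p < d + e |W|\<close>, then \<open>p G\<^sup>e\<close>
  is a polynomial of degree less than d. By duality, for all p of this degree the coefficient of
  \<open>x\<^sup>d\<close> in \<open>p G\<^sup>e\<close> is a linear combination of those Taylor coefficients. Take tensor products of such
  functionals with \<open>e\<^sub>i = r\<^sub>i + 1\<close>, \<open>d\<^sub>i \<le> r\<^sub>i\<close> and \<open>\<Sum>r\<^sub>i < k\<close>: if \<open>deg P < \<Sum>(d\<^sub>i + e\<^sub>i |W|)\<close>, then the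
  product of P and all \<open>G(x\<^sub>i)\<close> to the power \<open>e\<^sub>i\<close> has no term with exponents \<open>d\<^sub>i\<close>.

  This is a linear relation between the coefficients of P of low order. For k = 2 it reads P(0) = 0.
  For k = 3 and d = (1, 0, ...), the relations for r = (2, 0, ...) and r = (1, 1, 0, ...) differ by
  a multiple of P(0). For k = 4, one combines the relations for d = (2, 0, ...), r = (3, 0, ...) and
  r = (2, 1, 0, ...) with those for d = (1, 1, 0, ...), r = (1, 2, 0, ...) and r = (1, 1, 1, 0, ...).
  What remains is a nonzero multiple of P(0), since the coefficients of G are positive.

  For the upper bound take the planes \<open>x\<^sub>i = j\<close> and, for 1 \<open>\<le>\<close> r < k and 1 \<open>\<le>\<close> t \<open>\<le>\<close> rm, the plane
  where the coordinate sum is t: a point with c nonzero coordinates lies on c planes of the first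
  kind, and its coordinate sum is at most cm, so it lies on at least k - c of the second kind.
\<close>

subsection \<open>Polynomials in one variable\<close>

lemma functional_eq_plus_multiple_if_eq_on_kernel:
  fixes scale :: "'a::field \<Rightarrow> 'b::ab_group_add \<Rightarrow> 'b"
  assumes "module.subspace scale V" "Vector_Spaces.linear scale (*) \<phi>"
    "Vector_Spaces.linear scale (*) \<chi>" "Vector_Spaces.linear scale (*) \<psi>"
    and eq_on_kernel: "\<And>x. x \<in> V \<Longrightarrow> \<psi> x = 0 \<Longrightarrow> \<phi> x = \<chi> x"
  shows "\<exists>a. \<forall>x\<in>V. \<phi> x = \<chi> x + a * \<psi> x"
proof (cases "\<forall>x\<in>V. \<psi> x = 0")
  case True
  then show ?thesis using eq_on_kernel by simp
next
  case False
  then obtain u where u: "u \<in> V" "\<psi> u \<noteq> 0" by blast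
  interpret \<phi>: Vector_Spaces.linear scale "(*)" \<phi> by fact
  interpret \<chi>: Vector_Spaces.linear scale "(*)" \<chi> by fact
  interpret \<psi>: Vector_Spaces.linear scale "(*)" \<psi> by fact
  have "\<phi> x = \<chi> x + (\<phi> u - \<chi> u) / \<psi> u * \<psi> x" if "x \<in> V" for x
  proof -
    have "\<phi> (x - scale (\<psi> x / \<psi> u) u) = \<chi> (x - scale (\<psi> x / \<psi> u) u)"
    proof (rule eq_on_kernel)
      show "x - scale (\<psi> x / \<psi> u) u \<in> V"
        using that u assms(1) by (intro \<phi>.vs1.subspace_diff \<phi>.vs1.subspace_scale)
      show "\<psi> (x - scale (\<psi> x / \<psi> u) u) = 0"
        using u by (simp add: \<psi>.diff \<psi>.scale)
    qed
    then show ?thesis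
      by (simp add: \<phi>.diff \<phi>.scale \<chi>.diff \<chi>.scale diff_divide_distrib algebra_simps)
  qed
  then show ?thesis by blast
qed

lemma functional_in_span_if_zero_on_common_kernel:
  fixes scale :: "'a::field \<Rightarrow> 'b::ab_group_add \<Rightarrow> 'b"
  assumes "finite I" "module.subspace scale V" "Vector_Spaces.linear scale (*) \<phi>"
    and "\<And>i. i \<in> I \<Longrightarrow> Vector_Spaces.linear scale (*) (\<psi> i)"
    and "\<And>x. x \<in> V \<Longrightarrow> (\<And>i. i \<in> I \<Longrightarrow> \<psi> i x = 0) \<Longrightarrow> \<phi> x = 0"
  shows "\<exists>c. \<forall>x\<in>V. \<phi> x = (\<Sum>i\<in>I. c i * \<psi> i x)"
  using assms
proof (induction I arbitrary: V rule: finite_induct)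
  case empty
  then show ?case by simp
next
  case (insert j I)
  interpret \<psi>: Vector_Spaces.linear scale "(*)" "\<psi> j"
    by (rule insert.prems(3)) simp
  interpret pair: vector_space_pair scale "(*)" ..
  have "\<psi>.vs1.subspace (V \<inter> {x. \<psi> j x = 0})"
    using insert.prems(1) by (intro \<psi>.vs1.subspace_inter \<psi>.subspace_kernel)
  then have "\<exists>c. \<forall>x\<in>V \<inter> {x. \<psi> j x = 0}. \<phi> x = (\<Sum>i\<in>I. c i * \<psi> i x)"
    using insert.prems by (intro insert.IH) auto
  then obtain c where on_kernel: "\<And>x. x \<in> V \<Longrightarrow> \<psi> j x = 0 \<Longrightarrow> \<phi> x = (\<Sum>i\<in>I. c i * \<psi> i x)"
    by blast
  have "Vector_Spaces.linear scale (*) (\<lambda>x. \<Sum>i\<in>I. c i * \<psi> i x)"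
    using insert.prems(3)
    by (intro pair.linear_compose_sum ballI pair.linear_compose_scale_right) auto
  then obtain a where "\<And>x. x \<in> V \<Longrightarrow> \<phi> x = (\<Sum>i\<in>I. c i * \<psi> i x) + a * \<psi> j x"
    using functional_eq_plus_multiple_if_eq_on_kernel[OF insert.prems(1,2) _ insert.prems(3) on_kernel]
    by blast
  moreover have "(\<Sum>i\<in>I. (c(j := a)) i * \<psi> i x) = (\<Sum>i\<in>I. c i * \<psi> i x)" for x
    using insert.hyps by (intro sum.cong) auto
  ultimately show ?case
    using insert.hyps by (intro exI[of _ "c(j := a)"]) simp
qed

lemma pcompose_power:
  fixes p :: "'a::comm_ring_1 poly"
  shows "pcompose (p ^ n) q = pcompose p q ^ n"
  by (induction n) (simp_all add: pcompose_1 pcompose_mult)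

lemma linear_power_dvd_if_coeff_pcompose_eq_0:
  fixes p :: "'a::comm_ring_1 poly"
  assumes "\<And>s. s < e \<Longrightarrow> coeff (pcompose p [:v, 1:]) s = 0"
  shows "[:- v, 1:] ^ e dvd p"
proof -
  obtain q where "pcompose p [:v, 1:] = monom 1 e * q"
    using assms monom_1_dvd_iff' by blast
  then have "pcompose (pcompose p [:v, 1:]) [:- v, 1:]
      = pcompose (monom 1 e) [:- v, 1:] * pcompose q [:- v, 1:]"
    by (simp add: pcompose_mult)
  moreover have "pcompose [:v, 1:] [:- v, 1:] = [:0, 1:]"
    by (simp add: pcompose_pCons)
  moreover have "pcompose (monom 1 e) [:- v, 1:] = [:- v, 1:] ^ e"
    by (simp add: monom_altdef pcompose_power pcompose_pCons)
  ultimately show ?thesis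
    by (simp flip: pcompose_assoc)
qed

lemma prod_linear_power_dvd:
  fixes p :: "'a::idom poly"
  assumes "finite W" "\<And>w. w \<in> W \<Longrightarrow> [:- w, 1:] ^ e dvd p"
  shows "(\<Prod>w\<in>W. [:- w, 1:] ^ e) dvd p"
  using assms
proof (induction W)
  case empty
  show ?case by simp
next
  case (insert w W)
  let ?M = "\<Prod>w\<in>W. [:- w, 1:] ^ e"
  obtain q where p: "p = ?M * q"
    using insert by (auto elim: dvdE)
  have "poly ?M w \<noteq> 0"
    using insert.hyps by (auto simp: poly_prod)
  then have "?M \<noteq> 0" "order w ?M = 0"
    by (auto simp: order_0I)
  then have "order w (?M * q) = order w q" if "q \<noteq> 0"
    using that by (subst order_mult) auto
  then have "[:- w, 1:] ^ e dvd q"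
    using insert.prems[of w] \<open>?M \<noteq> 0\<close> by (cases "q = 0") (auto simp: order_divides p)
  then show ?case
    using insert.hyps by (simp add: p mult_dvd_mono mult.commute)
qed

lemma fps_power_nth_2:
  fixes F :: "'a::comm_ring_1 fps"
  assumes "fps_nth F 0 = 1"
  shows "fps_nth (F ^ e) 2 = of_nat e * fps_nth F 2 + of_nat (e choose 2) * (fps_nth F 1)\<^sup>2"
proof (induction e)
  case 0
  show ?case by (simp add: binomial_eq_0)
next
  case (Suc e)
  have "fps_nth (F ^ Suc e) 2
      = fps_nth (F ^ e) 2 + fps_nth F 1 * fps_nth (F ^ e) 1 + fps_nth F 2 * fps_nth (F ^ e) 0"
    using assms by (simp add: fps_mult_nth numeral_2_eq_2)
  moreover have "Suc e choose 2 = e + (e choose 2)"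
    by (simp add: numeral_2_eq_2)
  ultimately show ?case
    using assms by (simp only: Suc.IH fps_power_zeroth_eq_one fps_power_first_eq)
      (simp add: power2_eq_square algebra_simps)
qed

definition node_series :: "real set \<Rightarrow> real fps" where
  "node_series W = (\<Prod>w\<in>W. Abs_fps (\<lambda>r. (1 / w) ^ r))"

lemma node_series_nth_0: "fps_nth (node_series W) 0 = 1"
  unfolding node_series_def by (induction W rule: infinite_finite_induct) simp_all

lemma node_series_nth_pos:
  assumes "finite W" "W \<noteq> {}" "\<And>w. w \<in> W \<Longrightarrow> 0 < w"
  shows "0 < fps_nth (node_series W) r"
  using assms
proof (induction W arbitrary: r rule: finite_ne_induct)
  case (singleton w)
  then show ?case by (simp add: node_series_def)
next
  case (insert w W)
  then have "node_series (insert w W) = Abs_fps (\<lambda>r. (1 / w) ^ r) * node_series W"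
    by (simp add: node_series_def)
  then show ?case
    using insert by (auto simp: fps_mult_nth intro!: sum_pos)
qed

lemma node_series_power_nth:
  "fps_nth (node_series W ^ e) 0 = 1"
  "fps_nth (node_series W ^ e) (Suc 0) = real e * fps_nth (node_series W) 1"
  "fps_nth (node_series W ^ e) 2
    = real e * fps_nth (node_series W) 2 + real (e choose 2) * (fps_nth (node_series W) 1)\<^sup>2"
  using fps_power_first_eq[of "node_series W" e] fps_power_nth_2[of "node_series W" e]
  by (simp_all add: fps_power_zeroth_eq_one node_series_nth_0)

lemma linear_poly_times_geometric_series:
  fixes w :: "'a::field"
  assumes "w \<noteq> 0"
  shows "fps_of_poly [:- w, 1:] * Abs_fps (\<lambda>r. (1 / w) ^ r) = fps_const (- w)"
proof (rule fps_ext)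
  fix r
  show "fps_nth (fps_of_poly [:- w, 1:] * Abs_fps (\<lambda>r. (1 / w) ^ r)) r
      = fps_nth (fps_const (- w)) r"
    using assms by (cases r) (simp_all add: fps_of_poly_linear distrib_right)
qed

lemma node_poly_times_node_series_power:
  assumes "0 \<notin> W"
  shows "fps_of_poly (\<Prod>w\<in>W. [:- w, 1:] ^ e) * node_series W ^ e
    = fps_const (\<Prod>w\<in>W. (- w) ^ e)"
proof -
  have "fps_of_poly (\<Prod>w\<in>W. [:- w, 1:] ^ e) * node_series W ^ e
      = (\<Prod>w\<in>W. (fps_of_poly [:- w, 1:] * Abs_fps (\<lambda>r. (1 / w) ^ r)) ^ e)"
    by (simp add: node_series_def fps_of_poly_prod fps_of_poly_power prod_power_distrib
        power_mult_distrib flip: prod.distrib)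
  also have "\<dots> = (\<Prod>w\<in>W. fps_const ((- w) ^ e))"
    using assms by (intro prod.cong refl)
      (subst linear_poly_times_geometric_series, auto simp: fps_const_power)
  also have "\<dots> = fps_const (\<Prod>w\<in>W. (- w) ^ e)"
    by (induction W rule: infinite_finite_induct) simp_all
  finally show ?thesis .
qed

lemma nth_mult_node_series_power_eq_0:
  fixes p :: "real poly"
  assumes "finite W" "0 \<notin> W" "\<And>i. d + e * card W \<le> i \<Longrightarrow> coeff p i = 0"
    and "\<And>w s. w \<in> W \<Longrightarrow> s < e \<Longrightarrow> coeff (pcompose p [:w, 1:]) s = 0"
  shows "fps_nth (fps_of_poly p * node_series W ^ e) d = 0"
proof -
  let ?M = "\<Prod>w\<in>W. [:- w, 1:] ^ e"
  have "?M dvd p"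
    using assms by (intro prod_linear_power_dvd linear_power_dvd_if_coeff_pcompose_eq_0) auto
  then obtain q where p: "p = ?M * q" ..
  have "coeff q d = 0"
  proof (rule ccontr)
    assume "coeff q d \<noteq> 0"
    then have "q \<noteq> 0" "d \<le> degree q"
      by (auto simp: le_degree)
    moreover have "?M \<noteq> 0" "degree ?M = e * card W"
      using assms(1) by (simp_all add: degree_prod_eq_sum_degree degree_linear_power)
    ultimately have "p \<noteq> 0" "d + e * card W \<le> degree p"
      using p by (auto simp: degree_mult_eq)
    then show False
      using assms(3) leading_coeff_0_iff by blast
  qed
  moreover have "fps_of_poly p * node_series W ^ e
      = fps_of_poly ?M * node_series W ^ e * fps_of_poly q"
    by (simp add: p fps_of_poly_mult mult_ac)
  ultimately show ?thesis
    unfolding node_poly_times_node_series_power[OF assms(2)] by simp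
qed

definition taylor_coeff :: "real \<Rightarrow> nat \<Rightarrow> nat \<Rightarrow> real" where
  "taylor_coeff v s j = coeff ([:v, 1:] ^ j) s"

lemma taylor_coeff_Suc:
  "taylor_coeff v s (Suc j)
    = v * taylor_coeff v s j + (if s = 0 then 0 else taylor_coeff v (s - 1) j)"
  by (cases s) (simp_all add: taylor_coeff_def)

lemma taylor_coeff_0_left: "taylor_coeff 0 s j = of_bool (j = s)"
  using coeff_monom[of "1 :: real" j s] unfolding taylor_coeff_def monom_altdef by simp

lemma coeff_pcompose_monom: "coeff (pcompose (monom 1 j) [:v, 1:]) s = taylor_coeff v s j"
  by (simp add: monom_altdef taylor_coeff_def pcompose_power pcompose_pCons)

lemma nth_node_series_eq_taylor_sum:
  assumes "finite W" "0 \<notin> W"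
  shows "\<exists>c. \<forall>j < d + e * card W.
    fps_nth (fps_X ^ j * node_series W ^ e) d
      = (\<Sum>(w, s)\<in>W \<times> {..<e}. c (w, s) * taylor_coeff w s j)"
proof -
  interpret vector_space "smult :: real \<Rightarrow> real poly \<Rightarrow> real poly"
    by unfold_locales (simp_all add: smult_add_right smult_add_left)
  have real_field: "vector_space ((*) :: real \<Rightarrow> real \<Rightarrow> real)"
    by unfold_locales (simp_all add: algebra_simps)
  define V where "V = {p :: real poly. \<forall>i\<ge>d + e * card W. coeff p i = 0}"
  define \<phi> where "\<phi> = (\<lambda>p. fps_nth (fps_of_poly p * node_series W ^ e) d)"
  define \<psi> where "\<psi> = (\<lambda>(w, s) p. coeff (pcompose p [:w :: real, 1:]) s)"
  have "\<exists>c. \<forall>p\<in>V. \<phi> p = (\<Sum>x\<in>W \<times> {..<e}. c x * \<psi> x p)"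
  proof (rule functional_in_span_if_zero_on_common_kernel)
    show "finite (W \<times> {..<e})"
      using assms(1) by simp
    show "subspace V"
      by (simp add: V_def subspace_def)
    show "Vector_Spaces.linear smult (*) \<phi>"
      by (simp add: \<phi>_def Vector_Spaces.linear_iff fps_of_poly_add fps_of_poly_smult distrib_right
          mult.assoc vector_space_axioms real_field)
    show "Vector_Spaces.linear smult (*) (\<psi> x)" for x
      by (simp add: \<psi>_def Vector_Spaces.linear_iff pcompose_add pcompose_smult case_prod_unfold
          vector_space_axioms real_field)
    show "\<phi> p = 0" if "p \<in> V" "\<And>x. x \<in> W \<times> {..<e} \<Longrightarrow> \<psi> x p = 0" for p
      unfolding \<phi>_def
    proof (rule nth_mult_node_series_power_eq_0[OF assms])
      show "coeff (pcompose p [:w, 1:]) s = 0" if "w \<in> W" "s < e" for w s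
        using \<open>\<And>x. x \<in> W \<times> {..<e} \<Longrightarrow> \<psi> x p = 0\<close>[of "(w, s)"] that by (simp add: \<psi>_def)
    qed (use \<open>p \<in> V\<close> in \<open>simp add: V_def\<close>)
  qed
  then obtain c where combination: "\<And>p. p \<in> V \<Longrightarrow> \<phi> p = (\<Sum>x\<in>W \<times> {..<e}. c x * \<psi> x p)"
    by blast
  have "fps_nth (fps_X ^ j * node_series W ^ e) d
      = (\<Sum>(w, s)\<in>W \<times> {..<e}. c (w, s) * taylor_coeff w s j)" if "j < d + e * card W" for j
    using combination[of "monom 1 j"] that
    by (simp add: V_def \<phi>_def \<psi>_def fps_of_poly_monom' coeff_pcompose_monom case_prod_unfold)
  then show ?thesis by blast
qed

lemma annihilating_taylor_functional:
  assumes "finite W" "0 \<notin> W" "d \<le> r"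
  shows "\<exists>\<kappa>. (\<forall>j. (\<Sum>(v, s)\<in>{0} \<times> {..r}. \<kappa> (v, s) * taylor_coeff v s j)
        = fps_nth (fps_X ^ j * node_series W ^ Suc r) d) \<and>
    (\<forall>j < d + Suc r * card W. (\<Sum>(v, s)\<in>insert 0 W \<times> {..r}. \<kappa> (v, s) * taylor_coeff v s j) = 0)"
proof -
  define C where "C = (\<lambda>j. fps_nth (fps_X ^ j * node_series W ^ Suc r) d)"
  obtain c where combination: "\<And>j. j < d + Suc r * card W \<Longrightarrow>
      C j = (\<Sum>(v, s)\<in>W \<times> {..r}. c (v, s) * taylor_coeff v s j)"
    using nth_node_series_eq_taylor_sum[OF assms(1,2), of d "Suc r"]
    unfolding C_def lessThan_Suc_atMost by blast
  define \<kappa> where "\<kappa> = (\<lambda>(v, s). if v = 0 then C s else - c (v, s))"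
  have origin: "(\<Sum>(v, s)\<in>{0} \<times> {..r}. \<kappa> (v, s) * taylor_coeff v s j) = C j" for j
  proof -
    have "(\<Sum>(v, s)\<in>{0} \<times> {..r}. \<kappa> (v, s) * taylor_coeff v s j)
        = (\<Sum>s\<le>r. C s * of_bool (j = s))"
      unfolding sum.cartesian_product[symmetric] by (simp add: \<kappa>_def taylor_coeff_0_left)
    also have "\<dots> = C j"
      using assms(3) by (auto simp: C_def fps_X_power_mult_nth)
    finally show ?thesis .
  qed
  moreover have "(\<Sum>(v, s)\<in>insert 0 W \<times> {..r}. \<kappa> (v, s) * taylor_coeff v s j) = 0"
    if "j < d + Suc r * card W" for j
  proof -
    have "(\<Sum>(v, s)\<in>W \<times> {..r}. \<kappa> (v, s) * taylor_coeff v s j)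
        = (\<Sum>(v, s)\<in>W \<times> {..r}. - (c (v, s) * taylor_coeff v s j))"
      using assms(2) by (intro sum.cong) (auto simp: \<kappa>_def)
    also have "\<dots> = - C j"
      by (simp add: combination[OF that] sum_negf case_prod_unfold)
    finally show ?thesis
      using assms(1,2) origin[of j] by (simp flip: sum.cartesian_product)
  qed
  ultimately show ?thesis
    unfolding C_def by blast
qed

subsection \<open>Products of affine forms\<close>

text \<open>A functional on polynomials in n variables is given by its values on the monomials, indexed
  by their exponents; an affine form acts on it by the transpose of multiplication.\<close>

definition mult_form ::
  "nat \<Rightarrow> hplane \<Rightarrow> ((nat \<Rightarrow> nat) \<Rightarrow> real) \<Rightarrow> (nat \<Rightarrow> nat) \<Rightarrow> real" where
  "mult_form n h \<phi> \<beta> = (\<Sum>i<n. fst h i * \<phi> (\<beta>(i := Suc (\<beta> i)))) - snd h * \<phi> \<beta>"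

primrec value_at_product :: "nat \<Rightarrow> hplane list \<Rightarrow> ((nat \<Rightarrow> nat) \<Rightarrow> real) \<Rightarrow> real" where
  "value_at_product n [] \<phi> = \<phi> (\<lambda>_. 0)"
| "value_at_product n (h # hs) \<phi> = value_at_product n hs (mult_form n h \<phi>)"

lemma mult_form_add:
  "mult_form n h (\<lambda>\<alpha>. \<phi> \<alpha> + \<psi> \<alpha>) = (\<lambda>\<alpha>. mult_form n h \<phi> \<alpha> + mult_form n h \<psi> \<alpha>)"
  by (simp add: mult_form_def fun_eq_iff distrib_left sum.distrib)

lemma mult_form_cmult: "mult_form n h (\<lambda>\<alpha>. c * \<phi> \<alpha>) = (\<lambda>\<alpha>. c * mult_form n h \<phi> \<alpha>)"
  by (simp add: mult_form_def fun_eq_iff right_diff_distrib sum_distrib_left mult.left_commute)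

lemma value_at_product_add:
  "value_at_product n hs (\<lambda>\<alpha>. \<phi> \<alpha> + \<psi> \<alpha>) = value_at_product n hs \<phi> + value_at_product n hs \<psi>"
  by (induction hs arbitrary: \<phi> \<psi>) (simp_all add: mult_form_add)

lemma value_at_product_cmult:
  "value_at_product n hs (\<lambda>\<alpha>. c * \<phi> \<alpha>) = c * value_at_product n hs \<phi>"
  by (induction hs arbitrary: \<phi>) (simp_all add: mult_form_cmult)

lemma value_at_product_sum:
  "value_at_product n hs (\<lambda>\<alpha>. \<Sum>j\<in>S. c j * \<psi> j \<alpha>) = (\<Sum>j\<in>S. c j * value_at_product n hs (\<psi> j))"
  using value_at_product_cmult[of n hs 0]
  by (induction S rule: infinite_finite_induct)
    (simp_all add: value_at_product_add value_at_product_cmult)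

lemma value_at_product_eq_0_of_degree:
  assumes "\<And>\<alpha>. (\<Sum>i<n. \<alpha> i) < d \<Longrightarrow> \<phi> \<alpha> = 0" and "length hs < d"
  shows "value_at_product n hs \<phi> = 0"
  using assms
proof (induction hs arbitrary: \<phi> d)
  case Nil
  then show ?case by simp
next
  case (Cons h hs)
  have "mult_form n h \<phi> \<alpha> = 0" if "(\<Sum>i<n. \<alpha> i) < d - 1" for \<alpha>
  proof -
    have "(\<Sum>j<n. (\<alpha>(i := Suc (\<alpha> i))) j) = Suc (\<Sum>j<n. \<alpha> j)" if "i < n" for i
      using that by (simp add: sum.remove[of "{..<n}" i])
    with that show ?thesis
      unfolding mult_form_def by (auto intro!: sum.neutral simp: Cons.prems(1))
  qed
  moreover have "length hs < d - 1" using Cons.prems(2) by simp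
  ultimately have "value_at_product n hs (mult_form n h \<phi>) = 0"
    by (rule Cons.IH)
  then show ?case by simp
qed

lemma value_at_product_tensor_eq_0_of_degree:
  assumes "\<And>i j. i < n \<Longrightarrow> j < D i \<Longrightarrow> a i j = 0" and "length hs < (\<Sum>i<n. D i)"
  shows "value_at_product n hs (\<lambda>\<alpha>. \<Prod>i<n. a i (\<alpha> i)) = 0"
proof (rule value_at_product_eq_0_of_degree[OF _ assms(2)])
  fix \<alpha> :: "nat \<Rightarrow> nat"
  assume "(\<Sum>i<n. \<alpha> i) < (\<Sum>i<n. D i)"
  then have "\<exists>i<n. \<alpha> i < D i"
    by (meson leD lessThan_iff not_less sum_mono)
  then show "(\<Prod>i<n. a i (\<alpha> i)) = 0"
    using assms(1) by (auto intro!: prod_zero)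
qed

definition multi_taylor_coeff ::
  "nat \<Rightarrow> (nat \<Rightarrow> real) \<Rightarrow> (nat \<Rightarrow> nat) \<Rightarrow> (nat \<Rightarrow> nat) \<Rightarrow> real" where
  "multi_taylor_coeff n v s \<alpha> = (\<Prod>i<n. taylor_coeff (v i) (s i) (\<alpha> i))"

lemma multi_taylor_coeff_origin:
  "multi_taylor_coeff n (\<lambda>_. 0) s \<alpha> = of_bool (\<forall>i<n. \<alpha> i = s i)"
  by (auto simp: multi_taylor_coeff_def taylor_coeff_0_left)

lemma multi_taylor_coeff_Suc:
  assumes "i < n"
  shows "multi_taylor_coeff n v s (\<alpha>(i := Suc (\<alpha> i))) = v i * multi_taylor_coeff n v s \<alpha>
    + (if s i = 0 then 0 else multi_taylor_coeff n v (s(i := s i - 1)) \<alpha>)"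
proof -
  have "multi_taylor_coeff n v s' \<alpha>' = taylor_coeff (v i) (s' i) (\<alpha>' i)
      * (\<Prod>j\<in>{..<n} - {i}. taylor_coeff (v j) (s' j) (\<alpha>' j))" for s' \<alpha>'
    unfolding multi_taylor_coeff_def using assms by (subst prod.remove[of _ i]) auto
  then show ?thesis
    by (simp add: taylor_coeff_Suc algebra_simps)
qed

lemma mult_form_multi_taylor_coeff:
  "mult_form n h (multi_taylor_coeff n v s)
    = (\<lambda>\<alpha>. ((\<Sum>i<n. fst h i * v i) - snd h) * multi_taylor_coeff n v s \<alpha>
       + (\<Sum>i | i < n \<and> s i \<noteq> 0. fst h i * multi_taylor_coeff n v (s(i := s i - 1)) \<alpha>))"
proof
  fix \<alpha>
  have "(\<Sum>i<n. fst h i * multi_taylor_coeff n v s (\<alpha>(i := Suc (\<alpha> i))))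
      = (\<Sum>i<n. fst h i * v i) * multi_taylor_coeff n v s \<alpha>
      + (\<Sum>i<n. if s i \<noteq> 0 then fst h i * multi_taylor_coeff n v (s(i := s i - 1)) \<alpha> else 0)"
    unfolding sum_distrib_right sum.distrib[symmetric]
    by (intro sum.cong) (auto simp: multi_taylor_coeff_Suc algebra_simps)
  also have "(\<Sum>i<n. if s i \<noteq> 0 then fst h i * multi_taylor_coeff n v (s(i := s i - 1)) \<alpha> else 0)
      = (\<Sum>i | i < n \<and> s i \<noteq> 0. fst h i * multi_taylor_coeff n v (s(i := s i - 1)) \<alpha>)"
    by (subst sum.inter_filter[symmetric]) (auto intro!: sum.cong)
  finally show "mult_form n h (multi_taylor_coeff n v s) \<alpha>
    = ((\<Sum>i<n. fst h i * v i) - snd h) * multi_taylor_coeff n v s \<alpha>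
       + (\<Sum>i | i < n \<and> s i \<noteq> 0. fst h i * multi_taylor_coeff n v (s(i := s i - 1)) \<alpha>)"
    unfolding mult_form_def by (simp only: left_diff_distrib)
qed

lemma value_at_product_multi_taylor_coeff_eq_0:
  assumes "(\<Sum>i<n. s i) < cov n (mset hs) v"
  shows "value_at_product n hs (multi_taylor_coeff n v s) = 0"
  using assms
proof (induction hs arbitrary: s)
  case Nil
  then show ?case by (simp add: cov_def)
next
  case (Cons h hs)
  have "value_at_product n hs (multi_taylor_coeff n v (s(i := s i - 1))) = 0"
    if "i < n" "s i \<noteq> 0" for i
  proof -
    have "Suc (\<Sum>j<n. (s(i := s i - 1)) j) = (\<Sum>j<n. s j)"
      using that by (simp add: sum.remove[of "{..<n}" i])
    then show ?thesis
      using Cons.prems by (intro Cons.IH) (auto simp: cov_def split: if_splits)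
  qed
  moreover have "((\<Sum>i<n. fst h i * v i) - snd h)
      * value_at_product n hs (multi_taylor_coeff n v s) = 0"
    using Cons by (cases "on_hp n h v") (simp_all add: on_hp_def cov_def)
  ultimately show ?case
    by (simp add: mult_form_multi_taylor_coeff value_at_product_add value_at_product_cmult
        value_at_product_sum)
qed

lemma value_at_product_constant_coeff:
  "value_at_product n hs (multi_taylor_coeff n (\<lambda>_. 0) (\<lambda>_. 0)) = (\<Prod>h\<leftarrow>hs. - snd h)"
proof (induction hs)
  case Nil
  show ?case by (simp add: multi_taylor_coeff_origin)
next
  case (Cons h hs)
  then show ?case
    using value_at_product_cmult[of n hs "- snd h"] by (simp add: mult_form_multi_taylor_coeff)
qed

lemma value_at_product_tensor:
  assumes "\<And>i. i < n \<Longrightarrow> finite (K i)"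
  shows "value_at_product n hs (\<lambda>\<alpha>. \<Prod>i<n. \<Sum>(v, s)\<in>K i. \<kappa> i (v, s) * taylor_coeff v s (\<alpha> i))
    = (\<Sum>g\<in>PiE {..<n} K. (\<Prod>i<n. \<kappa> i (g i))
        * value_at_product n hs (multi_taylor_coeff n (fst \<circ> g) (snd \<circ> g)))"
proof -
  have "(\<lambda>\<alpha>. \<Prod>i<n. \<Sum>(v, s)\<in>K i. \<kappa> i (v, s) * taylor_coeff v s (\<alpha> i))
      = (\<lambda>\<alpha>. \<Sum>g\<in>PiE {..<n} K. (\<Prod>i<n. \<kappa> i (g i)) * multi_taylor_coeff n (fst \<circ> g) (snd \<circ> g) \<alpha>)"
    using assms by (intro ext, subst prod_sum_PiE)
      (auto simp: case_prod_unfold multi_taylor_coeff_def prod.distrib)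
  then show ?thesis
    by (simp only: value_at_product_sum)
qed

lemma value_at_product_tensor_eq_subset:
  assumes "\<And>i. i < n \<Longrightarrow> finite (K i)" "\<And>i. i < n \<Longrightarrow> L i \<subseteq> K i"
    and "\<And>g. g \<in> PiE {..<n} K - PiE {..<n} L \<Longrightarrow>
      value_at_product n hs (multi_taylor_coeff n (fst \<circ> g) (snd \<circ> g)) = 0"
  shows "value_at_product n hs (\<lambda>\<alpha>. \<Prod>i<n. \<Sum>(v, s)\<in>K i. \<kappa> i (v, s) * taylor_coeff v s (\<alpha> i))
    = value_at_product n hs (\<lambda>\<alpha>. \<Prod>i<n. \<Sum>(v, s)\<in>L i. \<kappa> i (v, s) * taylor_coeff v s (\<alpha> i))"
proof -
  have "finite (L i)" if "i < n" for i
    using assms(1,2) that finite_subset by blast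
  moreover have "finite (PiE {..<n} K)" "PiE {..<n} L \<subseteq> PiE {..<n} K"
    using assms(1,2) by (auto intro!: finite_PiE PiE_mono)
  ultimately show ?thesis
    using assms by (simp add: value_at_product_tensor sum.mono_neutral_right)
qed

lemma value_at_product_node_series_eq_0:
  assumes "finite W" "0 \<notin> W"
    and cover: "\<And>v. (\<And>i. i < n \<Longrightarrow> v i \<in> insert 0 W) \<Longrightarrow> \<exists>i<n. v i \<noteq> 0 \<Longrightarrow>
      (\<Sum>i<n. r i) < cov n (mset hs) v"
    and "\<And>i. i < n \<Longrightarrow> d i \<le> r i"
    and size: "length hs < (\<Sum>i<n. d i + Suc (r i) * card W)"
  shows "value_at_product n hs
    (\<lambda>\<alpha>. \<Prod>i<n. fps_nth (fps_X ^ \<alpha> i * node_series W ^ Suc (r i)) (d i)) = 0"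
proof -
  let ?T = "\<lambda>\<kappa> K j. \<Sum>(v, s)\<in>K. \<kappa> (v, s) * taylor_coeff v s j"
  define K where "K = (\<lambda>i. insert 0 W \<times> {..r i})"
  define L where "L = (\<lambda>i. {0 :: real} \<times> {..r i})"
  have "\<forall>i\<in>{..<n}. \<exists>\<kappa>. (\<forall>j. ?T \<kappa> (L i) j = fps_nth (fps_X ^ j * node_series W ^ Suc (r i)) (d i)) \<and>
      (\<forall>j < d i + Suc (r i) * card W. ?T \<kappa> (K i) j = 0)"
    unfolding K_def L_def using annihilating_taylor_functional assms(1,2,4) by simp
  then obtain \<kappa> where
    origin: "\<And>i j. i < n \<Longrightarrow>
      ?T (\<kappa> i) (L i) j = fps_nth (fps_X ^ j * node_series W ^ Suc (r i)) (d i)" and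
    annihilates: "\<And>i j. i < n \<Longrightarrow> j < d i + Suc (r i) * card W \<Longrightarrow> ?T (\<kappa> i) (K i) j = 0"
    unfolding bchoice_iff by auto
  have "value_at_product n hs (\<lambda>\<alpha>. \<Prod>i<n. ?T (\<kappa> i) (K i) (\<alpha> i)) = 0"
    using annihilates size by (rule value_at_product_tensor_eq_0_of_degree)
  moreover have "value_at_product n hs (\<lambda>\<alpha>. \<Prod>i<n. ?T (\<kappa> i) (K i) (\<alpha> i))
      = value_at_product n hs (\<lambda>\<alpha>. \<Prod>i<n. ?T (\<kappa> i) (L i) (\<alpha> i))"
  proof (rule value_at_product_tensor_eq_subset)
    fix g assume off_origin: "g \<in> PiE {..<n} K - PiE {..<n} L"
    then have "g i \<in> insert 0 W \<times> {..r i}" if "i < n" for i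
      using that by (auto simp: K_def dest: PiE_mem)
    then have "fst (g i) \<in> insert 0 W" "snd (g i) \<le> r i" if "i < n" for i
      using that by (auto simp: mem_Times_iff)
    moreover have "\<exists>i<n. fst (g i) \<noteq> 0"
      using off_origin by (force simp: PiE_iff K_def L_def)
    ultimately have "(\<Sum>i<n. (snd \<circ> g) i) < cov n (mset hs) (fst \<circ> g)"
      using cover[of "fst \<circ> g"] sum_mono[of "{..<n}" "snd \<circ> g" r] by (auto intro: le_less_trans)
    then show "value_at_product n hs (multi_taylor_coeff n (fst \<circ> g) (snd \<circ> g)) = 0"
      by (rule value_at_product_multi_taylor_coeff_eq_0)
  qed (use assms(1) in \<open>auto simp: K_def L_def\<close>)
  ultimately show ?thesis
    using origin by simp
qed

definition product_coeff :: "nat \<Rightarrow> hplane list \<Rightarrow> nat \<Rightarrow> nat \<Rightarrow> real" where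
  "product_coeff n hs a b = value_at_product n hs
    (\<lambda>\<alpha>. of_bool (\<alpha> 0 = a \<and> \<alpha> 1 = b \<and> (\<forall>i\<in>{2..<n}. \<alpha> i = 0)))"

lemma product_coeff_0_0_neq_0:
  assumes "n \<ge> 2" "cov n (mset hs) (\<lambda>_. 0) = 0"
  shows "product_coeff n hs 0 0 \<noteq> 0"
proof -
  have "(\<forall>i<n. \<alpha> i = 0) \<longleftrightarrow> \<alpha> 0 = 0 \<and> \<alpha> 1 = 0 \<and> (\<forall>i\<in>{2..<n}. \<alpha> i = 0)" for \<alpha> :: "nat \<Rightarrow> nat"
    using assms(1) by (auto simp: less_2_cases_iff not_less[symmetric] dest: leI)
  then have "product_coeff n hs 0 0 = (\<Prod>h\<leftarrow>hs. - snd h)"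
    unfolding product_coeff_def value_at_product_constant_coeff[of n, symmetric]
    by (simp add: multi_taylor_coeff_origin[abs_def])
  then show ?thesis
    using assms(2) by (auto simp: cov_def on_hp_def prod_list_zero_iff filter_mset_eq_conv)
qed

lemma fps_X_power_mult_nth_conv_sum:
  "fps_nth (fps_X ^ j * F) d = (\<Sum>a\<le>d. fps_nth F (d - a) * of_bool (j = a))"
  by (simp add: fps_X_power_mult_nth)

lemma prod_fps_X_power_mult_nth_two_variables:
  fixes G :: "nat \<Rightarrow> real fps"
  assumes "n \<ge> 2" "\<And>i. fps_nth (G i) 0 = 1"
  shows "(\<Prod>i<n. fps_nth (fps_X ^ \<alpha> i * G i) (((\<lambda>_. 0)(0 := d0, 1 := d1)) i))
    = (\<Sum>(a, b)\<in>{..d0} \<times> {..d1}. fps_nth (G 0) (d0 - a) * fps_nth (G 1) (d1 - b)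
        * of_bool (\<alpha> 0 = a \<and> \<alpha> 1 = b \<and> (\<forall>i\<in>{2..<n}. \<alpha> i = 0)))"
    (is "?lhs = _")
proof -
  let ?tail = "of_bool (\<forall>i\<in>{2..<n}. \<alpha> i = 0) :: real"
  have split: "{..<n} = insert 0 (insert 1 {2..<n})"
    using assms(1) by auto
  have "(\<Prod>i\<in>{2..<n}. fps_nth (fps_X ^ \<alpha> i * G i) (((\<lambda>_. 0)(0 := d0, 1 := d1)) i))
      = (\<Prod>i\<in>{2..<n}. of_bool (\<alpha> i = 0))"
    using assms(2) by (intro prod.cong) (auto simp: fps_X_power_mult_nth)
  also have "\<dots> = ?tail"
    by auto
  finally have "?lhs = fps_nth (fps_X ^ \<alpha> 0 * G 0) d0 * fps_nth (fps_X ^ \<alpha> 1 * G 1) d1 * ?tail"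
    unfolding split by simp
  also have "\<dots> = (\<Sum>a\<le>d0. fps_nth (G 0) (d0 - a) * of_bool (\<alpha> 0 = a))
      * (\<Sum>b\<le>d1. fps_nth (G 1) (d1 - b) * of_bool (\<alpha> 1 = b)) * ?tail"
    by (simp only: fps_X_power_mult_nth_conv_sum)
  also have "\<dots> = (\<Sum>(a, b)\<in>{..d0} \<times> {..d1}. fps_nth (G 0) (d0 - a) * fps_nth (G 1) (d1 - b)
      * of_bool (\<alpha> 0 = a \<and> \<alpha> 1 = b \<and> (\<forall>i\<in>{2..<n}. \<alpha> i = 0)))"
    unfolding sum_product unfolding sum_distrib_right
    by (simp only: sum.cartesian_product case_prod_unfold of_bool_conj mult_ac)
  finally show ?thesis .
qed

lemma product_coeff_relation:
  fixes r :: "nat \<Rightarrow> nat"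
  assumes "finite W" "0 \<notin> W" "n \<ge> 2"
    and "\<And>v. (\<And>i. i < n \<Longrightarrow> v i \<in> insert 0 W) \<Longrightarrow> \<exists>i<n. v i \<noteq> 0 \<Longrightarrow>
      (\<Sum>i<n. r i) < cov n (mset hs) v"
    and "d0 \<le> r 0" "d1 \<le> r 1"
    and "length hs < d0 + d1 + (n + (\<Sum>i<n. r i)) * card W"
  shows "(\<Sum>a\<le>d0. \<Sum>b\<le>d1. fps_nth (node_series W ^ Suc (r 0)) (d0 - a)
    * fps_nth (node_series W ^ Suc (r 1)) (d1 - b) * product_coeff n hs a b) = 0"
proof -
  define d where "d = (\<lambda>_ :: nat. 0)(0 := d0, 1 := d1)"
  define G where "G = (\<lambda>i. node_series W ^ Suc (r i))"
  have "{..<n} = insert 0 (insert 1 {2..<n})"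
    using assms(3) by auto
  then have "(\<Sum>i<n. d i) = d0 + d1"
    by (simp add: d_def)
  then have "(\<Sum>i<n. d i + Suc (r i) * card W) = d0 + d1 + (n + (\<Sum>i<n. r i)) * card W"
    by (simp add: sum.distrib sum_distrib_right distrib_right)
  then have "value_at_product n hs (\<lambda>\<alpha>. \<Prod>i<n. fps_nth (fps_X ^ \<alpha> i * G i) (d i)) = 0"
    using assms unfolding G_def
    by (intro value_at_product_node_series_eq_0) (auto simp: d_def)
  moreover have "fps_nth (G i) 0 = 1" for i
    by (simp add: G_def fps_power_zeroth_eq_one node_series_nth_0 del: power_Suc)
  ultimately have "value_at_product n hs (\<lambda>\<alpha>. \<Sum>(a, b)\<in>{..d0} \<times> {..d1}.
      fps_nth (G 0) (d0 - a) * fps_nth (G 1) (d1 - b)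
        * of_bool (\<alpha> 0 = a \<and> \<alpha> 1 = b \<and> (\<forall>i\<in>{2..<n}. \<alpha> i = 0))) = 0"
    unfolding d_def using assms(3) by (simp only: prod_fps_X_power_mult_nth_two_variables)
  then show ?thesis
    unfolding G_def product_coeff_def
    by (simp only: case_prod_unfold value_at_product_sum sum.cartesian_product)
qed

lemma grid_product_coeff_relation:
  assumes adm: "admissible m n k (mset hs)" and order: "r0 + r1 + r2 < k"
    and "n \<ge> 2" "n > 2 \<or> r2 = 0" "d0 \<le> r0" "d1 \<le> r1"
    and "length hs < d0 + d1 + (n + (r0 + r1 + r2)) * m"
  shows "(\<Sum>a\<le>d0. \<Sum>b\<le>d1. fps_nth (node_series (real ` {1..m}) ^ Suc r0) (d0 - a)
    * fps_nth (node_series (real ` {1..m}) ^ Suc r1) (d1 - b) * product_coeff n hs a b) = 0"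
proof -
  define r where "r = (\<lambda>_ :: nat. 0)(0 := r0, 1 := r1, 2 := r2)"
  have "(\<Sum>i<n. r i) = (\<Sum>i\<in>{0, 1, 2}. r i)"
    using assms(3,4) by (intro sum.mono_neutral_cong) (auto simp: r_def)
  then have sum_r: "(\<Sum>i<n. r i) = r0 + r1 + r2"
    by (simp add: r_def)
  have r: "r 0 = r0" "r 1 = r1"
    by (simp_all add: r_def)
  have nodes: "real ` {0..m} = insert 0 (real ` {1..m})"
    by (force simp: image_iff Suc_le_eq)
  have "(\<Sum>i<n. r i) < cov n (mset hs) v"
    if "\<And>i. i < n \<Longrightarrow> v i \<in> insert 0 (real ` {1..m})" "\<exists>i<n. v i \<noteq> 0" for v
  proof -
    define x where "x = (\<lambda>i. if i < n then v i else 0)"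
    have "x \<in> grid m n - {\<lambda>_. 0}"
      using that nodes by (auto simp: grid_def x_def fun_eq_iff)
    then have "k \<le> cov n (mset hs) x"
      using adm by (auto simp: admissible_def)
    also have "cov n (mset hs) x = cov n (mset hs) v"
      by (simp add: cov_def on_hp_def x_def)
    finally show ?thesis using order by (simp add: sum_r)
  qed
  then show ?thesis
    using assms sum_r
    by (intro product_coeff_relation[of "real ` {1..m}" n r hs d0 d1, unfolded r])
      (auto simp: card_image)
qed

subsection \<open>Bounds for coverings of the grid\<close>

lemma length_ge_if_admissible_2:
  assumes "admissible m n 2 (mset hs)" "n \<ge> 2"
  shows "(n + 1) * m \<le> length hs"
proof (rule ccontr)
  assume "\<not> ?thesis"
  then have "product_coeff n hs 0 0 = 0"
    using grid_product_coeff_relation[of m n 2 hs 1 0 0 0 0] assms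
    by (simp add: node_series_nth_0)
  then show False
    using assms product_coeff_0_0_neq_0[of n hs] by (simp add: admissible_def)
qed

lemma length_ge_if_admissible_3:
  assumes "admissible m n 3 (mset hs)" "n \<ge> 2" "m > 0"
  shows "(n + 2) * m + 1 \<le> length hs"
proof (rule ccontr)
  assume "\<not> ?thesis"
  then have size: "length hs < 1 + 0 + (n + 2) * m" by simp
  let ?g = "fps_nth (node_series (real ` {1..m}))"
  have "?g 1 > 0"
    using assms(3) by (intro node_series_nth_pos) auto
  let ?X = "product_coeff n hs"
  have "?X 1 0 + 3 * ?g 1 * ?X 0 0 = 0"
    using grid_product_coeff_relation[of m n 3 hs 2 0 0 1 0] assms size
    by (simp add: node_series_power_nth node_series_nth_0)
  moreover have "?X 1 0 + 2 * ?g 1 * ?X 0 0 = 0"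
    using grid_product_coeff_relation[of m n 3 hs 1 1 0 1 0] assms size
    by (simp add: node_series_power_nth node_series_nth_0)
  ultimately have "?g 1 * ?X 0 0 = 0"
    by algebra
  then show False
    using \<open>?g 1 > 0\<close> assms product_coeff_0_0_neq_0[of n hs] by (simp add: admissible_def)
qed

lemma length_ge_if_admissible_4:
  assumes "admissible m n 4 (mset hs)" "n \<ge> 3" "m > 0"
  shows "(n + 3) * m + 2 \<le> length hs"
proof (rule ccontr)
  assume "\<not> ?thesis"
  then have size: "length hs < 2 + 0 + (n + 3) * m" "length hs < 1 + 1 + (n + 3) * m"
    by simp_all
  let ?g = "fps_nth (node_series (real ` {1..m}))"
  have "?g 2 > 0"
    using assms(3) by (intro node_series_nth_pos) auto
  then have pos: "?g 2 + (?g 1)\<^sup>2 > 0"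
    by (simp add: add_pos_nonneg)
  let ?X = "product_coeff n hs"
  have "?X 2 0 + 4 * ?g 1 * ?X 1 0 + (4 * ?g 2 + 6 * (?g 1)\<^sup>2) * ?X 0 0 = 0"
    using grid_product_coeff_relation[of m n 4 hs 3 0 0 2 0] assms size
    by (simp add: node_series_power_nth node_series_nth_0 atMost_nat_numeral choose_two)
  moreover have "?X 2 0 + 3 * ?g 1 * ?X 1 0 + (3 * ?g 2 + 3 * (?g 1)\<^sup>2) * ?X 0 0 = 0"
    using grid_product_coeff_relation[of m n 4 hs 2 1 0 2 0] assms size
    by (simp add: node_series_power_nth node_series_nth_0 atMost_nat_numeral choose_two)
  ultimately have "?g 1 * ?X 1 0 + (?g 2 + 3 * (?g 1)\<^sup>2) * ?X 0 0 = 0"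
    by algebra
  moreover have "?X 1 1 + 2 * ?g 1 * ?X 0 1 + 3 * ?g 1 * ?X 1 0 + 6 * (?g 1)\<^sup>2 * ?X 0 0 = 0"
    using grid_product_coeff_relation[of m n 4 hs 1 2 0 1 1] assms size
    by (simp add: node_series_power_nth node_series_nth_0 power2_eq_square algebra_simps)
  moreover have "?X 1 1 + 2 * ?g 1 * ?X 0 1 + 2 * ?g 1 * ?X 1 0 + 4 * (?g 1)\<^sup>2 * ?X 0 0 = 0"
    using grid_product_coeff_relation[of m n 4 hs 1 1 1 1 1] assms size
    by (simp add: node_series_power_nth node_series_nth_0 power2_eq_square algebra_simps)
  ultimately have "(?g 2 + (?g 1)\<^sup>2) * ?X 0 0 = 0"
    by algebra
  then show False
    using pos assms product_coeff_0_0_neq_0[of n hs] by (simp add: admissible_def)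
qed

definition coordinate_hplanes :: "nat \<Rightarrow> nat \<Rightarrow> hplane multiset" where
  "coordinate_hplanes m n = (\<Sum>i<n. \<Sum>j=1..m. {#(\<lambda>l. of_bool (l = i), real j)#})"

definition layer_hplanes :: "nat \<Rightarrow> nat \<Rightarrow> hplane multiset" where
  "layer_hplanes m q = (\<Sum>r=1..q. \<Sum>t=1..r * m. {#(\<lambda>_. 1, real t)#})"

lemma size_sum_multiset: "size (\<Sum>i\<in>A. F i :: 'a multiset) = (\<Sum>i\<in>A. size (F i))"
  by (induction A rule: infinite_finite_induct) auto

lemma cov_sum: "cov n (\<Sum>i\<in>A. F i) x = (\<Sum>i\<in>A. cov n (F i) x)"
  by (induction A rule: infinite_finite_induct) (auto simp: cov_def)

lemma cov_single: "cov n {#h#} x = of_bool (on_hp n h x)"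
  by (simp add: cov_def)

lemma size_coordinate_hplanes: "size (coordinate_hplanes m n) = m * n"
  by (simp add: coordinate_hplanes_def size_sum_multiset)

lemma size_layer_hplanes: "size (layer_hplanes m q) = m * (Suc q choose 2)"
proof -
  have "(\<Sum>r=1..q. r) = Suc q choose 2"
    using gauss_sum_from_Suc_0[of q, where ?'a = nat] by (simp add: choose_two mult.commute)
  then show ?thesis
    by (simp add: layer_hplanes_def size_sum_multiset mult.commute flip: sum_distrib_right)
qed

lemma grid_sum_bounds:
  assumes "x \<in> grid m n" "x \<noteq> (\<lambda>_. 0)"
  obtains t where "(\<Sum>i<n. x i) = real t" "1 \<le> t" "t \<le> card {i. i < n \<and> x i \<noteq> 0} * m"
proof -
  define S where "S = {i. i < n \<and> x i \<noteq> 0}"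
  have "\<forall>i\<in>{..<n}. \<exists>a. x i = real a \<and> a \<le> m"
    using assms(1) by (auto simp: grid_def)
  then obtain y where y: "\<And>i. i < n \<Longrightarrow> x i = real (y i)" "\<And>i. i < n \<Longrightarrow> y i \<le> m"
    unfolding bchoice_iff by auto
  show ?thesis
  proof
    show "(\<Sum>i<n. x i) = real (\<Sum>i\<in>S. y i)"
      unfolding of_nat_sum by (intro sum.mono_neutral_cong_right) (auto simp: S_def y)
    have "\<exists>i. x i \<noteq> 0"
      using assms(2) by auto
    then obtain i where "i \<in> S"
      using assms(1) by (auto simp: grid_def S_def simp flip: not_le)
    moreover have "y i \<ge> 1" if "i \<in> S" for i
      using that y(1)[of i] by (auto simp: S_def Suc_le_eq)
    ultimately show "1 \<le> (\<Sum>i\<in>S. y i)"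
      using member_le_sum[of i S y] by (force simp: S_def)
    show "(\<Sum>i\<in>S. y i) \<le> card {i. i < n \<and> x i \<noteq> 0} * m"
      using sum_bounded_above[of S y m] y by (auto simp: S_def)
  qed
qed

lemma cov_coordinate_hplanes:
  assumes "x \<in> grid m n"
  shows "cov n (coordinate_hplanes m n) x = card {i. i < n \<and> x i \<noteq> 0}"
proof -
  have "(\<Sum>j=1..m. cov n {#(\<lambda>l. of_bool (l = i), real j)#} x) = of_bool (x i \<noteq> 0)"
    if "i < n" for i
  proof -
    have "x i \<in> real ` {0..m}"
      using assms that by (simp add: grid_def)
    then obtain a where a: "x i = real a" "a \<le> m"
      by auto
    have "on_hp n (\<lambda>l. of_bool (l = i), real j) x \<longleftrightarrow> j = a" for j
      using that a by (auto simp: on_hp_def)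
    then show ?thesis
      using a by (auto simp: cov_single)
  qed
  then have "cov n (coordinate_hplanes m n) x = (\<Sum>i<n. of_bool (x i \<noteq> 0))"
    unfolding coordinate_hplanes_def cov_sum by (intro sum.cong) auto
  also have "\<dots> = card {i. i < n \<and> x i \<noteq> 0}"
    by (simp add: Int_def)
  finally show ?thesis .
qed

lemma cov_layer_hplanes_ge:
  assumes "x \<in> grid m n" "x \<noteq> (\<lambda>_. 0)"
  shows "Suc q - card {i. i < n \<and> x i \<noteq> 0} \<le> cov n (layer_hplanes m q) x"
proof -
  obtain t where t: "(\<Sum>i<n. x i) = real t" "1 \<le> t" "t \<le> card {i. i < n \<and> x i \<noteq> 0} * m"
    using grid_sum_bounds[OF assms] by blast
  define c where "c = card {i. i < n \<and> x i \<noteq> 0}"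
  have "c > 0"
    using t(2,3) unfolding c_def[symmetric] by (cases c) auto
  have t_le: "t \<le> r * m" if "c \<le> r" for r
    using t(3) mult_le_mono1[OF that, of m] unfolding c_def by linarith
  have "Suc q - c = (\<Sum>r=c..q. 1)"
    by simp
  also have "\<dots> \<le> (\<Sum>r=c..q. of_bool (t \<le> r * m))"
    by (intro sum_mono) (simp add: t_le)
  also have "\<dots> \<le> (\<Sum>r=1..q. of_bool (t \<le> r * m))"
    using \<open>c > 0\<close> by (intro sum_mono2) auto
  also have "\<dots> = cov n (layer_hplanes m q) x"
  proof -
    have "(\<Sum>j=1..r * m. cov n {#(\<lambda>_. 1, real j)#} x) = of_bool (t \<le> r * m)" for r
      using t(1,2) by (auto simp: cov_single on_hp_def)
    then show ?thesis
      by (simp only: layer_hplanes_def cov_sum)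
  qed
  finally show ?thesis
    by (simp add: c_def)
qed

lemma admissible_coordinate_layer_hplanes:
  assumes "n > 0"
  shows "admissible m n (Suc q) (coordinate_hplanes m n + layer_hplanes m q)"
  unfolding admissible_def
proof (intro conjI ballI)
  fix h assume "h \<in># coordinate_hplanes m n + layer_hplanes m q"
  then show "is_hyperplane n h"
    using assms
    by (auto simp: coordinate_hplanes_def layer_hplanes_def set_mset_sum is_hyperplane_def)
next
  fix x assume "x \<in> grid m n - {\<lambda>_. 0}"
  then show "Suc q \<le> cov n (coordinate_hplanes m n + layer_hplanes m q) x"
    using cov_coordinate_hplanes[of x m n] cov_layer_hplanes_ge[of x m n q]
    by (simp add: cov_def)
next
  show "cov n (coordinate_hplanes m n + layer_hplanes m q) (\<lambda>_. 0) = 0"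
    by (auto simp: cov_def filter_mset_eq_conv coordinate_hplanes_def layer_hplanes_def set_mset_sum
        on_hp_def)
qed

lemma f_upper_bound:
  assumes "n > 0" "k > 0"
  shows "f m n k \<le> m * n + m * (k choose 2)"
  unfolding f_def
  using admissible_coordinate_layer_hplanes[OF assms(1), of m "k - 1"] assms(2)
  by (intro Least_le exI[of _ "coordinate_hplanes m n + layer_hplanes m (k - 1)"])
    (simp add: size_coordinate_hplanes size_layer_hplanes)

lemma f_attained:
  assumes "n > 0" "k > 0"
  obtains hs where "admissible m n k (mset hs)" "length hs = f m n k"
proof -
  have "\<exists>H. admissible m n k H \<and> size H = f m n k"
    unfolding f_def
  proof (rule LeastI_ex)
    show "\<exists>s H. admissible m n k H \<and> size H = s"
      using admissible_coordinate_layer_hplanes[OF assms(1), of m "k - 1"] assms(2) by auto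
  qed
  then obtain H where "admissible m n k H" "size H = f m n k"
    by blast
  moreover obtain hs where "H = mset hs"
    by (metis ex_mset)
  ultimately show ?thesis
    using that[of hs] by simp
qed

lemma f_lower_bound:
  assumes "m > 0" "k \<in> {2, 3, 4}" "n \<ge> 2" "n \<ge> k - 1"
  shows "m * n + (m + 1) * (k - 1) - 1 \<le> f m n k"
proof -
  have "n > 0" "k > 0"
    using assms by auto
  then obtain hs where hs: "admissible m n k (mset hs)" "length hs = f m n k"
    by (rule f_attained)
  consider "k = 2" | "k = 3" | "k = 4"
    using assms(2) by auto
  then show ?thesis
  proof cases
    assume "k = 2"
    then show ?thesis
      using length_ge_if_admissible_2[of m n hs] hs assms by (simp add: algebra_simps)
  next
    assume "k = 3"
    then show ?thesis
      using length_ge_if_admissible_3[of m n hs] hs assms by (simp add: algebra_simps)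
  next
    assume "k = 4"
    then show ?thesis
      using length_ge_if_admissible_4[of m n hs] hs assms by (simp add: algebra_simps)
  qed
qed

theorem theorem1p4:
  fixes m n :: nat
  assumes "m > 0" and "n > 0"
  shows "(n \<ge> 2 \<longrightarrow> f m n 2 = m * n + m) \<and>
         (\<forall>k\<in>{3, 4}. n \<ge> k - 1 \<longrightarrow>
            m * n + (m + 1) * (k - 1) - 1 \<le> f m n k \<and>
            f m n k \<le> m * n + m * (k choose 2))"
proof (intro conjI impI ballI)
  assume "n \<ge> 2"
  then show "f m n 2 = m * n + m"
    using f_upper_bound[of n 2 m] f_lower_bound[of m 2 n] assms by simp
next
  fix k :: nat
  assume "k \<in> {3, 4}" "n \<ge> k - 1"
  then show "m * n + (m + 1) * (k - 1) - 1 \<le> f m n k"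
    using assms by (intro f_lower_bound) auto
next
  fix k :: nat
  assume "k \<in> {3, 4}"
  then show "f m n k \<le> m * n + m * (k choose 2)"
    using assms by (intro f_upper_bound) auto
qed

end
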